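(* Let $X = \{ x \in \mathbb{R}^n : g_1(x) \ge 0,\ldots, g_s(x) \ge 0\}$, with $g_1,\ldots,g_s \in \mathbb{R}[x]=\mathbb{R}[x_1,\ldots,x_n]$, be a compact semialgebraic set contained in the ball $\{ x \in \mathbb{R}^n : x_1^2 + \cdots + x_n^2 \le \rho\}$ for some $\rho \in \mathbb{R}_{>0}$. Let $g_0(x) := 1$ and $g_{s+1}(x) := \rho - (x_1^2 + \cdots + x_n^2)$. Then, for every finite set $A \subseteq \mathbb{N}^n \setminus \{0\}$, one has $$\mathcal{M}_A(X) = \left\{ v \in \mathbb{R}^{\mathbb{N}^n} : v_0 = 1, \ L_v(g_i M_{\mathbb{N}^n}) \succeq 0 \ \text{for all} \ i=0,\ldots,s+1 \right\}_A .$$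
   Context: $\mathbb{N}$ contains $0$. For $\alpha \in \mathbb{N}^n$, $x^\alpha = x_1^{\alpha_1}\cdots x_n^{\alpha_n}$. For a finite $A \subseteq \mathbb{N}^n$, the moment body is $\mathcal{M}_A(X) := \operatorname{conv}\{ (x^\alpha)_{\alpha \in A} : x \in X\} \subseteq \mathbb{R}^A$. For $v=(v_\alpha)$ the linearization $L_v$ is the linear map with $L_v(\sum_\alpha f_\alpha x^\alpha) = \sum_\alpha f_\alpha v_\alpha$; it is applied to matrices with polynomial entries entrywise. $M_{\mathbb{N}^n} = x^{\mathbb{N}^n}(x^{\mathbb{N}^n})^\top$ is the infinite symmetric matrix indexed by $\mathbb{N}^n \times \mathbb{N}^n$ with $(\alpha,\beta)$ entry $x^{\alpha+\beta}$. For a symmetric real matrix $M = (m_{i,j})_{i,j \in I}$ with infinite index set $I$, $M \succeq 0$ means that $(m_{i,j})_{i,j \in B}$ is positive semidefinite for every finite $B \subseteq I$. For $Y \subseteq \mathbb{R}^{\mathbb{N}^n}$, $Y_A = \{ (y_\alpha)_{\alpha \in A} : y \in Y\}$ is the projection of $Y$ onto the coordinates indexed by $A$. *)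

theory Defs
  imports "HOL-Analysis.Analysis" "HOL-Analysis.Finite_Function_Topology"
begin

text \<open>
  The ring \<open>\<real>[x\<^sub>1, \<dots>, x\<^sub>n]\<close> is the monoid algebra of \<open>\<nat>\<^sup>n\<close> over \<open>\<real>\<close>: a polynomial is the finitely
  supported family of its coefficients, and \<open>*\<close> is convolution. The index type \<open>'n\<close> plays the role
  of \<open>{1, \<dots>, n}\<close>.
\<close>

type_synonym 'n expo = "nat ^ 'n"
type_synonym 'n mpoly = "'n expo \<Rightarrow>\<^sub>0 real"

definition monom_eval :: "real ^ 'n \<Rightarrow> 'n::finite expo \<Rightarrow> real" where
  "monom_eval x \<alpha> = (\<Prod>i\<in>UNIV. (x $ i) ^ (\<alpha> $ i))"

definition mpoly_eval :: "'n::finite mpoly \<Rightarrow> real ^ 'n \<Rightarrow> real" where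
  "mpoly_eval f x = (\<Sum>\<alpha>\<in>Poly_Mapping.keys f. Poly_Mapping.lookup f \<alpha> * monom_eval x \<alpha>)"

definition mconst :: "real \<Rightarrow> 'n::finite mpoly" where
  "mconst c = Poly_Mapping.single 0 c"

definition mvar :: "'n \<Rightarrow> 'n::finite mpoly" where
  "mvar i = Poly_Mapping.single (axis i 1) 1"

text \<open>
  The space \<open>\<real>\<^sup>A\<close>, for a finite set \<open>A\<close> of exponents, is realised as the subspace of families supported
  in \<open>A\<close> inside the real vector space of finitely supported families on \<open>\<nat>\<^sup>n\<close>; \<open>proj A v\<close> is
  \<open>(v\<^sub>\<alpha>)\<close> for \<open>\<alpha> \<in> A\<close>. It is meaningful for finite \<open>A\<close> only.
\<close>

definition proj :: "'n::finite expo set \<Rightarrow> ('n expo \<Rightarrow> real) \<Rightarrow> 'n expo \<Rightarrow>\<^sub>0 real" where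
  "proj A v = (\<Sum>\<alpha>\<in>A. Poly_Mapping.single \<alpha> (v \<alpha>))"

definition moment_body :: "'n::finite expo set \<Rightarrow> (real ^ 'n) set \<Rightarrow> ('n expo \<Rightarrow>\<^sub>0 real) set" where
  "moment_body A X = convex hull ((\<lambda>x. proj A (monom_eval x)) ` X)"

lemma lookup_proj:
  "finite A \<Longrightarrow> Poly_Mapping.lookup (proj A v) \<alpha> = (if \<alpha> \<in> A then v \<alpha> else 0)"
  by (simp add: proj_def lookup_sum lookup_single when_def)

definition linearize :: "('n::finite expo \<Rightarrow> real) \<Rightarrow> 'n mpoly \<Rightarrow> real" where
  "linearize v f = (\<Sum>\<alpha>\<in>Poly_Mapping.keys f. Poly_Mapping.lookup f \<alpha> * v \<alpha>)"

text \<open>Matrices with index set \<open>'i\<close> are functions \<open>'i \<Rightarrow> 'i \<Rightarrow> _\<close>.\<close>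

definition moment_matrix :: "'n::finite expo \<Rightarrow> 'n expo \<Rightarrow> 'n mpoly" where
  "moment_matrix \<alpha> \<beta> = Poly_Mapping.single (\<alpha> + \<beta>) 1"

definition psd_on :: "'i set \<Rightarrow> ('i \<Rightarrow> 'i \<Rightarrow> real) \<Rightarrow> bool" where
  "psd_on B M \<longleftrightarrow> (\<forall>i\<in>B. \<forall>j\<in>B. M i j = M j i) \<and>
     (\<forall>z. 0 \<le> (\<Sum>i\<in>B. \<Sum>j\<in>B. z i * M i j * z j))"

definition psd_infinite :: "('i \<Rightarrow> 'i \<Rightarrow> real) \<Rightarrow> bool" where
  "psd_infinite M \<longleftrightarrow> (\<forall>B. finite B \<longrightarrow> psd_on B M)"

end

theory Submission
  imports Defs
begin

text \<open>
  Let \<open>K\<close> be the set on the right-hand side before projection. It is convex, and compact in the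
  product topology. For \<open>v \<in> K\<close> and \<open>c > sqrt \<rho>\<close> the functionals \<open>p \<mapsto> L\<^sub>v ((c \<plusminus> x\<^sub>j) p)\<close> satisfy the same
  positivity conditions, so they write \<open>v\<close> as a convex combination of two points of \<open>K\<close>. If \<open>v\<close>
  minimises \<open>L\<^sub>v f\<close> over \<open>K\<close> for a polynomial \<open>f\<close> and, among the minimisers, maximises the strictly
  convex function \<open>\<Sum>\<^sub>j L\<^sub>v (x\<^sub>j)\<^sup>2\<close>, this combination is trivial on the coordinates, whence
  \<open>L\<^sub>v (x\<^sub>j\<^sup>2) = L\<^sub>v (x\<^sub>j)\<^sup>2\<close>. By Cauchy-Schwarz \<open>L\<^sub>v\<close> is then multiplicative, that is, evaluation at a
  point of \<open>X\<close>. So every linear functional on \<open>K\<close> is bounded below by its value at a point of \<open>X\<close>, and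
  the theorem follows by separating from the compact convex moment body.
\<close>

subsection \<open>Linearization and nonnegativity on squares\<close>

lemma linearize_superset:
  assumes "finite S" "Poly_Mapping.keys f \<subseteq> S"
  shows "linearize v f = (\<Sum>\<alpha>\<in>S. Poly_Mapping.lookup f \<alpha> * v \<alpha>)"
  unfolding linearize_def
  using assms by (intro sum.mono_neutral_left) (auto simp: in_keys_iff)

lemma linearize_zero [simp]: "linearize v 0 = 0"
  by (simp add: linearize_def)

lemma linearize_single [simp]: "linearize v (Poly_Mapping.single \<alpha> c) = c * v \<alpha>"
  by (simp add: linearize_def)

lemma linearize_one [simp]: "linearize v 1 = v 0"
  using linearize_single[of v 0 1] by simp

lemma linearize_add: "linearize v (f + h) = linearize v f + linearize v h"
proof -
  let ?S = "Poly_Mapping.keys f \<union> Poly_Mapping.keys h"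
  have "finite ?S" "Poly_Mapping.keys (f + h) \<subseteq> ?S"
    using keys_add[of f h] by auto
  then show ?thesis
    by (simp add: linearize_superset[of ?S] lookup_add distrib_right sum.distrib)
qed

lemma linearize_uminus: "linearize v (- f) = - linearize v f"
  using linearize_add[of v f "- f"] by simp

lemma linearize_diff: "linearize v (f - h) = linearize v f - linearize v h"
  using linearize_add[of v f "- h"] by (simp add: linearize_uminus)

lemma linearize_sum: "linearize v (sum f S) = (\<Sum>i\<in>S. linearize v (f i))"
  by (induction S rule: infinite_finite_induct) (simp_all add: linearize_add)

lemma mpoly_expand: "f = (\<Sum>\<alpha>\<in>Poly_Mapping.keys f. Poly_Mapping.single \<alpha> (Poly_Mapping.lookup f \<alpha>))"
  by (rule poly_mapping_eqI) (simp add: lookup_sum lookup_single when_def in_keys_iff)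

lemma single_eq_mconst_mult: "Poly_Mapping.single \<alpha> c = mconst c * Poly_Mapping.single \<alpha> 1"
  by (simp add: mconst_def mult_single)

lemma linearize_mconst_mult: "linearize v (mconst c * f) = c * linearize v f"
proof -
  have "linearize v (mconst c * f) =
      (\<Sum>\<alpha>\<in>Poly_Mapping.keys f. c * (Poly_Mapping.lookup f \<alpha> * v \<alpha>))"
    by (subst mpoly_expand[of f])
      (simp add: sum_distrib_left linearize_sum mconst_def mult_single mult.assoc)
  then show ?thesis
    by (simp add: linearize_def sum_distrib_left)
qed

text \<open>The moments of the functional \<open>p \<mapsto> L_v (h p)\<close>; its moment matrix is
  the localizing matrix of \<open>h\<close>.\<close>

definition twist :: "'n::finite mpoly \<Rightarrow> ('n expo \<Rightarrow> real) \<Rightarrow> 'n expo \<Rightarrow> real" where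
  "twist h v \<alpha> = linearize v (h * Poly_Mapping.single \<alpha> 1)"

lemma linearize_twist: "linearize (twist h v) f = linearize v (h * f)"
proof -
  have "linearize v (h * f) = (\<Sum>\<alpha>\<in>Poly_Mapping.keys f.
      linearize v (h * Poly_Mapping.single \<alpha> (Poly_Mapping.lookup f \<alpha>)))"
    by (subst mpoly_expand[of f]) (simp add: sum_distrib_left linearize_sum)
  also have "\<dots> = linearize (twist h v) f"
    by (simp add: linearize_def[of "twist h v"] twist_def
        single_eq_mconst_mult[of _ "Poly_Mapping.lookup _ _"] mult.left_commute[of h]
        linearize_mconst_mult)
  finally show ?thesis ..
qed

lemma linearize_combination:
  "linearize (\<lambda>\<alpha>. a * v \<alpha> + b * w \<alpha>) f = a * linearize v f + b * linearize w f"
  by (simp add: linearize_def sum_distrib_left flip: sum.distrib) (simp add: algebra_simps)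

section \<open>Point evaluations as linearizations\<close>

lemma mpoly_eval_linearize: "mpoly_eval f x = linearize (monom_eval x) f"
  by (simp add: mpoly_eval_def linearize_def)

lemma monom_eval_0 [simp]: "monom_eval x 0 = 1"
  by (simp add: monom_eval_def)

lemma monom_eval_add: "monom_eval x (\<alpha> + \<beta>) = monom_eval x \<alpha> * monom_eval x \<beta>"
  by (simp add: monom_eval_def power_add prod.distrib)

lemma monom_eval_axis [simp]: "monom_eval x (axis i 1) = x $ i"
proof -
  have "(x $ j) ^ (axis i (1::nat) $ j) = (if j = i then x $ j else 1)" for j
    by (simp add: axis_def)
  then show ?thesis
    by (simp add: monom_eval_def)
qed

lemma mpoly_eval_mult: "mpoly_eval (f * h) x = mpoly_eval f x * mpoly_eval h x"
proof -
  have "twist f (monom_eval x) \<alpha> = mpoly_eval f x * monom_eval x \<alpha>" for \<alpha>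
  proof -
    have "f * Poly_Mapping.single \<alpha> 1 = (\<Sum>\<beta>\<in>Poly_Mapping.keys f.
        Poly_Mapping.single (\<beta> + \<alpha>) (Poly_Mapping.lookup f \<beta>))"
      by (subst mpoly_expand[of f]) (simp add: sum_distrib_right mult_single)
    then show ?thesis
      by (simp add: twist_def linearize_sum monom_eval_add mpoly_eval_def sum_distrib_right mult.assoc)
  qed
  then have "linearize (twist f (monom_eval x)) h = mpoly_eval f x * mpoly_eval h x"
    by (simp add: linearize_def[of "twist _ _"] mpoly_eval_def[of h] sum_distrib_left algebra_simps)
  then show ?thesis
    by (simp add: linearize_twist mpoly_eval_linearize)
qed

definition nonneg_on_squares :: "('n::finite expo \<Rightarrow> real) \<Rightarrow> bool" where
  "nonneg_on_squares v \<longleftrightarrow> (\<forall>p. 0 \<le> linearize v (p * p))"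

lemma linearize_square_sum:
  "linearize w ((\<Sum>i\<in>B. Poly_Mapping.single i (z i)) * (\<Sum>i\<in>B. Poly_Mapping.single i (z i))) =
    (\<Sum>i\<in>B. \<Sum>j\<in>B. z i * w (i + j) * z j)"
  by (simp add: sum_product linearize_sum mult_single algebra_simps)

text \<open>The quadratic form of a finite block at a vector \<open>z\<close> is the functional at
  the square of the polynomial with coefficients \<open>z\<close>. Symmetry is automatic because the
  entries depend only on \<open>\<alpha> + \<beta>\<close>.\<close>

lemma psd_infinite_iff:
  fixes v :: "'n::finite expo \<Rightarrow> real"
  shows "psd_infinite (\<lambda>\<alpha> \<beta>. linearize v (h * moment_matrix \<alpha> \<beta>)) \<longleftrightarrow> nonneg_on_squares (twist h v)"
proof -
  have eq: "linearize v (h * moment_matrix \<alpha> \<beta>) = twist h v (\<alpha> + \<beta>)" for \<alpha> \<beta>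
    by (simp add: twist_def moment_matrix_def)
  show ?thesis
    unfolding eq
  proof
    assume psd: "psd_infinite (\<lambda>\<alpha> \<beta>. twist h v (\<alpha> + \<beta>))"
    show "nonneg_on_squares (twist h v)"
      unfolding nonneg_on_squares_def
    proof
      fix p :: "'n mpoly"
      have "psd_on (Poly_Mapping.keys p) (\<lambda>\<alpha> \<beta>. twist h v (\<alpha> + \<beta>))"
        using psd by (simp add: psd_infinite_def)
      then show "0 \<le> linearize (twist h v) (p * p)"
        by (subst (1 2) mpoly_expand[of p]) (simp only: linearize_square_sum psd_on_def)
    qed
  next
    assume "nonneg_on_squares (twist h v)"
    then have "0 \<le> (\<Sum>i\<in>B. \<Sum>j\<in>B. z i * twist h v (i + j) * z j)" for B z
      unfolding nonneg_on_squares_def linearize_square_sum[symmetric] by blast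
    then show "psd_infinite (\<lambda>\<alpha> \<beta>. twist h v (\<alpha> + \<beta>))"
      by (simp add: psd_infinite_def psd_on_def add.commute)
  qed
qed

text \<open>The binary form \<open>(s, t) \<mapsto> L_v ((s p + t q)^2)\<close> is nonnegative,
  which bounds its discriminant.\<close>

lemma nonneg_on_squares_Cauchy_Schwarz:
  assumes "nonneg_on_squares v"
  shows "(linearize v (p * q))\<^sup>2 \<le> linearize v (p * p) * linearize v (q * q)"
proof -
  define a where "a = linearize v (p * p)"
  define b where "b = linearize v (p * q)"
  define c where "c = linearize v (q * q)"
  have quad: "0 \<le> s\<^sup>2 * a + 2 * s * t * b + t\<^sup>2 * c" for s t
  proof -
    let ?r = "mconst s * p + mconst t * q"
    have "?r * ?r = mconst s * (mconst s * (p * p)) + mconst s * (mconst t * (p * q))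
        + mconst s * (mconst t * (p * q)) + mconst t * (mconst t * (q * q))"
      by (simp add: algebra_simps)
    then have "linearize v (?r * ?r) = s * (s * a) + s * (t * b) + s * (t * b) + t * (t * c)"
      by (simp only: linearize_add linearize_mconst_mult a_def b_def c_def)
    then have "linearize v (?r * ?r) = s\<^sup>2 * a + 2 * s * t * b + t\<^sup>2 * c"
      by (simp add: power2_eq_square)
    moreover have "0 \<le> linearize v (?r * ?r)"
      using assms by (simp add: nonneg_on_squares_def)
    ultimately show ?thesis
      by simp
  qed
  have ac: "0 \<le> a" "0 \<le> c"
    using quad[of 1 0] quad[of 0 1] by simp_all
  show ?thesis
    unfolding a_def[symmetric] b_def[symmetric] c_def[symmetric]
  proof (cases "c = 0")
    case True
    have "b = 0"
    proof (rule ccontr)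
      assume "b \<noteq> 0"
      \<comment> \<open>With \<open>c = 0\<close> and \<open>s = 1\<close> the form is affine in
        \<open>t\<close>; this \<open>t\<close> gives it the value \<open>- 1\<close>.\<close>
      have "0 \<le> a + 2 * (- (a + 1) / (2 * b)) * b"
        using quad[of 1 "- (a + 1) / (2 * b)"] True by simp
      also have "\<dots> = - 1"
        using \<open>b \<noteq> 0\<close> by (simp add: field_simps)
      finally show False by simp
    qed
    then show "b\<^sup>2 \<le> a * c"
      using True by simp
  next
    case False
    \<comment> \<open>At \<open>(s, t) = (c, - b)\<close> the form splits off the factor
      \<open>c\<close>, which is positive here.\<close>
    have "0 \<le> c * (a * c - b\<^sup>2)"
      using quad[of c "- b"] by (simp add: power2_eq_square algebra_simps)
    then show "b\<^sup>2 \<le> a * c"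
      using ac False by (simp add: zero_le_mult_iff)
  qed
qed

subsection \<open>States on Archimedean quadratic modules\<close>

text \<open>Log-convexity makes successive ratios nondecreasing, so a first ratio
  \<open>r > \<rho>\<close> would force growth of order \<open>r ^ k\<close>, against the
  bound.\<close>

lemma log_convex_exponential_bound:
  fixes a :: "nat \<Rightarrow> real"
  assumes nonneg: "\<And>k. 0 \<le> a k"
    and log_convex: "\<And>k. (a (Suc k))\<^sup>2 \<le> a k * a (Suc (Suc k))"
    and bound: "\<And>k. a k \<le> C * \<rho> ^ k" and "\<rho> > 0"
  shows "a 1 \<le> \<rho> * a 0"
proof (rule ccontr)
  assume contr: "\<not> a 1 \<le> \<rho> * a 0"
  have "a 0 \<noteq> 0"
    using contr log_convex[of 0] by auto
  then have "a 0 > 0"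
    using nonneg[of 0] by simp
  define r where "r = a 1 / a 0"
  have "r > \<rho>"
    using contr \<open>a 0 > 0\<close> by (simp add: r_def pos_less_divide_eq)
  then have "r > 0"
    using \<open>\<rho> > 0\<close> by simp
  \<comment> \<open>Positivity is carried along because the induction step cancels
    \<open>a k\<close>.\<close>
  have step: "0 < a k \<and> r * a k \<le> a (Suc k)" for k
  proof (induction k)
    case 0
    then show ?case
      using \<open>a 0 > 0\<close> by (simp add: r_def)
  next
    case (Suc k)
    then have pos: "0 < a (Suc k)"
      using \<open>r > 0\<close> by (meson less_le_trans mult_pos_pos)
    have "a k * (r * a (Suc k)) \<le> a (Suc k) * a (Suc k)"
      using Suc pos mult_right_mono[of "r * a k" "a (Suc k)" "a (Suc k)"]
      by (simp add: mult.left_commute mult.commute)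
    also have "\<dots> \<le> a k * a (Suc (Suc k))"
      using log_convex[of k] by (simp add: power2_eq_square)
    finally show ?case
      using Suc pos by simp
  qed
  have growth: "r ^ k * a 0 \<le> a k" for k
  proof (induction k)
    case (Suc k)
    have "r ^ Suc k * a 0 \<le> r * a k"
      using Suc \<open>r > 0\<close> by (simp add: mult.assoc)
    then show ?case
      using step[of k] by linarith
  qed simp
  obtain k where k: "C / a 0 < (r / \<rho>) ^ k"
    using real_arch_pow[of "r / \<rho>" "C / a 0"] \<open>r > \<rho>\<close> \<open>\<rho> > 0\<close> by auto
  have "r ^ k * a 0 \<le> C * \<rho> ^ k"
    using growth[of k] bound[of k] by linarith
  then have "(r / \<rho>) ^ k \<le> C / a 0"
    using \<open>a 0 > 0\<close> \<open>\<rho> > 0\<close> by (simp add: power_divide field_simps)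
  with k show False
    by simp
qed

text \<open>Induction on the total degree; adding \<open>axis j 1\<close> multiplies the monomial by
  \<open>x_j\<close>.\<close>

lemma expo_induct [case_names zero add_axis]:
  fixes \<alpha> :: "'n::finite expo"
  assumes "P 0" and step: "\<And>j \<alpha>. P \<alpha> \<Longrightarrow> P (axis j 1 + \<alpha>)"
  shows "P \<alpha>"
proof (induction "\<Sum>i\<in>UNIV. \<alpha> $ i" arbitrary: \<alpha>)
  case 0
  then have "\<alpha> = 0"
    by (simp add: vec_eq_iff)
  then show ?case
    using assms by simp
next
  case (Suc m)
  obtain j where j: "\<alpha> $ j \<noteq> 0"
    using Suc.hyps(2) by fastforce
  define \<beta> where "\<beta> = (\<chi> i. if i = j then \<alpha> $ i - 1 else \<alpha> $ i)"
  have \<alpha>: "\<alpha> = axis j 1 + \<beta>"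
    using j by (simp add: \<beta>_def vec_eq_iff axis_def)
  have "(\<Sum>i\<in>UNIV. axis j (1::nat) $ i) = 1"
    by (simp add: axis_def)
  then have "(\<Sum>i\<in>UNIV. \<alpha> $ i) = 1 + (\<Sum>i\<in>UNIV. \<beta> $ i)"
    by (simp add: \<alpha> sum.distrib)
  then have "P \<beta>"
    using Suc by simp
  then show ?case
    unfolding \<alpha> by (rule step)
qed

lemma mvar_mult_single:
  "mvar j * Poly_Mapping.single \<alpha> c = Poly_Mapping.single (axis j 1 + \<alpha>) c"
  by (simp add: mvar_def mult_single)

lemma twist_affine:
  "twist (mconst c + mconst e * mvar j) v \<alpha> = c * v \<alpha> + e * v (axis j 1 + \<alpha>)"
  by (simp add: twist_def distrib_right mult.assoc mvar_mult_single linearize_add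
      linearize_mconst_mult)

lemma linearize_scale: "linearize (\<lambda>\<alpha>. a * v \<alpha>) f = a * linearize v f"
  using linearize_combination[of a v 0 v f] by simp

text \<open>The ball polynomial makes the quadratic module generated by \<open>G\<close>
  Archimedean; apart from it and \<open>1\<close>, the generators are arbitrary.\<close>

locale archimedean_generators =
  fixes G :: "'n::finite mpoly set" and \<rho> :: real
  assumes one_in: "1 \<in> G"
    and ball_in: "mconst \<rho> - (\<Sum>i\<in>UNIV. (mvar i)\<^sup>2) \<in> G"
    and rho_pos: "\<rho> > 0"
begin

text \<open>Dual cone of the quadratic module generated by \<open>G\<close>.\<close>

definition psd_cone :: "('n expo \<Rightarrow> real) set" where
  "psd_cone = {v. \<forall>h\<in>G. nonneg_on_squares (twist h v)}"

section \<open>Bounds obtained from the ball polynomial\<close>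

lemma psd_coneD: "v \<in> psd_cone \<Longrightarrow> h \<in> G \<Longrightarrow> 0 \<le> linearize v (h * (p * p))"
  by (simp add: psd_cone_def nonneg_on_squares_def linearize_twist)

lemma psd_cone_nonneg_on_squares: "v \<in> psd_cone \<Longrightarrow> nonneg_on_squares v"
  using psd_coneD[OF _ one_in] by (simp add: nonneg_on_squares_def)

lemma mvar_square_le:
  assumes "v \<in> psd_cone"
  shows "linearize v (mvar j * mvar j * (p * p)) \<le> \<rho> * linearize v (p * p)"
proof -
  let ?a = "\<lambda>i. linearize v (mvar i * mvar i * (p * p))"
  have nonneg: "0 \<le> ?a i" for i
    using psd_coneD[OF assms one_in, of "mvar i * p"] by (simp add: ac_simps)
  have "(mconst \<rho> - (\<Sum>i\<in>UNIV. (mvar i)\<^sup>2)) * (p * p) =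
      mconst \<rho> * (p * p) - (\<Sum>i\<in>UNIV. mvar i * mvar i * (p * p))"
    by (simp add: left_diff_distrib sum_distrib_right power2_eq_square)
  then have "(\<Sum>i\<in>UNIV. ?a i) \<le> \<rho> * linearize v (p * p)"
    using psd_coneD[OF assms ball_in, of p]
    by (simp add: linearize_diff linearize_sum linearize_mconst_mult)
  moreover have "?a j \<le> (\<Sum>i\<in>UNIV. ?a i)"
    by (rule member_le_sum) (use nonneg in auto)
  ultimately show ?thesis
    by linarith
qed

lemma mvar_power_le:
  assumes "v \<in> psd_cone"
  shows "linearize v (mvar j ^ k * mvar j ^ k) \<le> \<rho> ^ k * v 0"
proof (induction k)
  case (Suc k)
  have "linearize v (mvar j ^ Suc k * mvar j ^ Suc k) \<le> \<rho> * linearize v (mvar j ^ k * mvar j ^ k)"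
    using mvar_square_le[OF assms, of j "mvar j ^ k"] by (simp add: ac_simps)
  also have "\<dots> \<le> \<rho> * (\<rho> ^ k * v 0)"
    using Suc rho_pos by simp
  finally show ?case
    by (simp add: mult.assoc)
qed simp

text \<open>Cauchy-Schwarz separates \<open>f\<close> from the even power of \<open>x_j\<close>.
  What matters is that the factor in front of \<open>\<rho> ^ k\<close> does not depend on
  \<open>k\<close>.\<close>

lemma mult_mvar_power_le:
  assumes v: "v \<in> psd_cone"
  shows "linearize v (f * (mvar j ^ k * mvar j ^ k)) \<le> sqrt (linearize v (f * f) * v 0) * \<rho> ^ k"
proof -
  let ?m = "mvar j ^ k * mvar j ^ k"
  have pos: "nonneg_on_squares v"
    using v by (rule psd_cone_nonneg_on_squares)
  have "?m * ?m = mvar j ^ (2 * k) * mvar j ^ (2 * k)"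
    by (simp only: mult_2 power_add mult.assoc)
  then have "linearize v (?m * ?m) \<le> \<rho> ^ (2 * k) * v 0"
    using mvar_power_le[OF v] by metis
  moreover have "0 \<le> linearize v (f * f)"
    using pos by (simp add: nonneg_on_squares_def)
  ultimately have "linearize v (f * f) * linearize v (?m * ?m)
      \<le> linearize v (f * f) * (\<rho> ^ (2 * k) * v 0)"
    by (rule mult_left_mono)
  with nonneg_on_squares_Cauchy_Schwarz[OF pos, of f ?m]
  have "(linearize v (f * ?m))\<^sup>2 \<le> linearize v (f * f) * v 0 * (\<rho> ^ k)\<^sup>2"
    by (simp add: power_mult[symmetric] ac_simps)
  then have "\<bar>linearize v (f * ?m)\<bar> \<le> sqrt (linearize v (f * f) * v 0 * (\<rho> ^ k)\<^sup>2)"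
    using real_le_rsqrt by fastforce
  then show ?thesis
    using rho_pos by (simp add: real_sqrt_mult)
qed

text \<open>
  The bound of \<open>mvar_square_le\<close> transfers to each twist of \<open>v\<close>, although products of generators
  need not lie in the quadratic module: the moments of the twist along \<open>x\<^sub>j\<close> form a log-convex
  sequence which grows no faster than those of \<open>v\<close>.
\<close>

lemma twist_mvar_square_le:
  assumes v: "v \<in> psd_cone" and h: "h \<in> G"
  shows "linearize (twist h v) (mvar j * mvar j * (p * p)) \<le> \<rho> * linearize (twist h v) (p * p)"
proof -
  define a where "a k = linearize (twist h v) ((mvar j ^ k * p) * (mvar j ^ k * p))" for k
  have pos: "nonneg_on_squares (twist h v)"
    using v h by (simp add: psd_cone_def)
  have "a 1 \<le> \<rho> * a 0"
  proof (rule log_convex_exponential_bound)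
    show "0 \<le> a k" for k
      using pos by (simp add: a_def nonneg_on_squares_def)
    \<comment> \<open>The exponents \<open>k\<close> and \<open>k + 2\<close> average to
      \<open>k + 1\<close>, so the mixed term of Cauchy-Schwarz is \<open>a (Suc k)\<close>.\<close>
    show "(a (Suc k))\<^sup>2 \<le> a k * a (Suc (Suc k))" for k
      using nonneg_on_squares_Cauchy_Schwarz[OF pos,
          of "mvar j ^ k * p" "mvar j ^ Suc (Suc k) * p"]
      by (simp add: a_def ac_simps)
    \<comment> \<open>The generator \<open>h\<close> is absorbed into the arbitrary polynomial
      \<open>f = h * (p * p)\<close>, so the growth is measured by \<open>v\<close> itself.\<close>
    show "a k \<le> sqrt (linearize v ((h * (p * p)) * (h * (p * p))) * v 0) * \<rho> ^ k" for k
      using mult_mvar_power_le[OF v, of "h * (p * p)" j k]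
      by (simp add: a_def linearize_twist ac_simps)
  qed (rule rho_pos)
  then show ?thesis
    by (simp add: a_def ac_simps)
qed

text \<open>Here \<open>e\<close> is a sign. For each twist \<open>w\<close> by a generator,
  Cauchy-Schwarz and \<open>twist_mvar_square_le\<close> give
  \<open>|L_w (x_j p p)| \<le> sqrt \<rho> * L_w (p p)\<close>, so \<open>c + e x_j\<close> acts as
  a nonnegative multiplier.\<close>

lemma twist_affine_in_psd_cone:
  assumes v: "v \<in> psd_cone" and c: "c \<ge> sqrt \<rho>" and e: "\<bar>e\<bar> = 1"
  shows "twist (mconst c + mconst e * mvar j) v \<in> psd_cone"
  unfolding psd_cone_def nonneg_on_squares_def mem_Collect_eq
proof (intro ballI allI)
  fix h p assume h: "h \<in> G"
  define w where "w = twist h v"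
  have pos: "nonneg_on_squares w"
    using v h by (simp add: psd_cone_def w_def)
  let ?A = "linearize w (p * p)" and ?B = "linearize w (mvar j * p * p)"
  have A: "0 \<le> ?A"
    using pos by (simp add: nonneg_on_squares_def)
  have "?B\<^sup>2 \<le> linearize w ((mvar j * p) * (mvar j * p)) * ?A"
    using nonneg_on_squares_Cauchy_Schwarz[OF pos, of "mvar j * p" p] by simp
  also have "\<dots> \<le> (\<rho> * ?A) * ?A"
    using twist_mvar_square_le[OF v h, of j p] A
    by (intro mult_right_mono) (simp_all add: w_def ac_simps)
  finally have "?B\<^sup>2 \<le> \<rho> * ?A\<^sup>2"
    by (simp add: power2_eq_square)
  then have "\<bar>?B\<bar> \<le> sqrt (\<rho> * ?A\<^sup>2)"
    using real_le_rsqrt by fastforce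
  also have "\<dots> = sqrt \<rho> * ?A"
    using A by (simp add: real_sqrt_mult)
  also have "\<dots> \<le> c * ?A"
    using c A by (rule mult_right_mono)
  finally have "\<bar>e * ?B\<bar> \<le> c * ?A"
    using e by (simp add: abs_mult)
  then have "0 \<le> c * ?A + e * ?B"
    by linarith
  moreover have "(mconst c + mconst e * mvar j) * (h * (p * p)) =
      mconst c * (h * (p * p)) + mconst e * (h * (mvar j * p * p))"
    by (simp add: algebra_simps)
  then have "linearize (twist h (twist (mconst c + mconst e * mvar j) v)) (p * p) = c * ?A + e * ?B"
    by (simp add: linearize_twist w_def linearize_add linearize_mconst_mult)
  ultimately show "0 \<le> linearize (twist h (twist (mconst c + mconst e * mvar j) v)) (p * p)"
    by simp
qed

lemma scale_in_psd_cone: "v \<in> psd_cone \<Longrightarrow> 0 \<le> a \<Longrightarrow> (\<lambda>\<alpha>. a * v \<alpha>) \<in> psd_cone"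
  by (simp add: psd_cone_def nonneg_on_squares_def linearize_twist linearize_scale)

section \<open>Compactness of the set \<open>K\<close> of normalised functionals\<close>

definition moment_states :: "('n expo \<Rightarrow> real) set" where
  "moment_states = {v \<in> psd_cone. v 0 = 1}"

text \<open>Each further factor \<open>x_j\<close> costs at most a factor \<open>\<rho>\<close>. The
  bound is uniform in the state, as the compactness argument requires.\<close>

lemma moment_states_diagonal_bounded:
  "\<exists>B\<ge>0. \<forall>v\<in>moment_states. v (\<alpha> + \<alpha>) \<le> B"
proof (induction \<alpha> rule: expo_induct)
  case zero
  show ?case
    by (rule exI[of _ 1]) (simp add: moment_states_def)
next
  case (add_axis j \<alpha>)
  then obtain B where B: "B \<ge> 0" "\<And>v. v \<in> moment_states \<Longrightarrow> v (\<alpha> + \<alpha>) \<le> B"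
    by blast
  have "v (axis j 1 + \<alpha> + (axis j 1 + \<alpha>)) \<le> \<rho> * B" if "v \<in> moment_states" for v
  proof -
    have "v (axis j 1 + \<alpha> + (axis j 1 + \<alpha>)) =
        linearize v (mvar j * mvar j * (Poly_Mapping.single \<alpha> 1 * Poly_Mapping.single \<alpha> 1))"
      by (simp add: mvar_def mult_single ac_simps)
    also have "\<dots> \<le> \<rho> * linearize v (Poly_Mapping.single \<alpha> 1 * Poly_Mapping.single \<alpha> 1)"
      using that by (intro mvar_square_le) (simp add: moment_states_def)
    also have "\<dots> \<le> \<rho> * B"
      using B(2)[OF that] rho_pos by (simp add: mult_single)
    finally show ?thesis .
  qed
  then show ?case
    using B(1) rho_pos by (intro exI[of _ "\<rho> * B"]) simp
qed

lemma square_moment_le: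
  assumes "v \<in> moment_states"
  shows "(v \<alpha>)\<^sup>2 \<le> v (\<alpha> + \<alpha>)"
proof -
  have "nonneg_on_squares v" "v 0 = 1"
    using assms psd_cone_nonneg_on_squares by (auto simp: moment_states_def)
  then show ?thesis
    using nonneg_on_squares_Cauchy_Schwarz[of v "Poly_Mapping.single \<alpha> 1" 1]
    by (simp add: mult_single)
qed

lemma continuous_linearize: "continuous_on S (\<lambda>v. linearize v f)"
  unfolding linearize_def
  by (intro continuous_intros continuous_on_subset[OF continuous_on_product_coordinates]) simp

text \<open>Even moments dominate the squares of all moments, so the states lie in a product of
  intervals, compact by Tychonoff. Each defining condition involves finitely many coordinates and is
  closed.\<close>

lemma compact_moment_states: "compact moment_states"
proof -
  obtain B where B: "\<And>\<alpha> v. v \<in> moment_states \<Longrightarrow> v (\<alpha> + \<alpha>) \<le> B \<alpha>"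
    using moment_states_diagonal_bounded by metis
  define box where "box = PiE UNIV (\<lambda>\<alpha>. {- sqrt (B \<alpha>)..sqrt (B \<alpha>)})"
  have "compactin (product_topology (\<lambda>_. euclidean) UNIV) box"
    unfolding box_def compactin_PiE by simp
  then have "compact box"
    by (simp add: euclidean_product_topology)
  moreover have "closed moment_states"
  proof -
    have "moment_states = {v. v 0 = 1} \<inter> (\<Inter>h\<in>G. \<Inter>p. {v. 0 \<le> linearize v (h * (p * p))})"
      by (auto simp: moment_states_def psd_cone_def nonneg_on_squares_def linearize_twist)
    moreover have "closed {v :: 'n expo \<Rightarrow> real. v 0 = 1}"
      by (intro closed_Collect_eq) auto
    moreover have "closed {v. 0 \<le> linearize v f}" for f :: "'n mpoly"
      by (intro closed_Collect_le continuous_linearize continuous_on_const)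
    ultimately show ?thesis
      by (auto intro!: closed_Int closed_INT)
  qed
  moreover have "moment_states \<subseteq> box"
  proof
    fix v assume v: "v \<in> moment_states"
    have "\<bar>v \<alpha>\<bar> \<le> sqrt (B \<alpha>)" for \<alpha>
      using square_moment_le[OF v, of \<alpha>] B[OF v, of \<alpha>] by (intro real_le_rsqrt) simp
    then show "v \<in> box"
      by (auto simp: box_def abs_le_iff minus_le_iff)
  qed
  ultimately show ?thesis
    by (metis closed_Int_compact Int_absorb2)
qed

text \<open>The normalised twists by \<open>c + x_j\<close> and \<open>c - x_j\<close> are states
  averaging to \<open>v\<close>. Minimality makes both minimisers, maximality makes them agree on
  the coordinates, and agreement at \<open>x_j\<close> is the variance identity.\<close>

lemma extremal_state_zero_variance:
  assumes v: "v \<in> moment_states"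
    and minimal: "\<And>w. w \<in> moment_states \<Longrightarrow> linearize v f \<le> linearize w f"
    and maximal: "\<And>w. w \<in> moment_states \<Longrightarrow> linearize w f = linearize v f \<Longrightarrow>
      (\<Sum>i\<in>UNIV. (w (axis i 1))\<^sup>2) \<le> (\<Sum>i\<in>UNIV. (v (axis i 1))\<^sup>2)"
  shows "v (axis j 1 + axis j 1) = (v (axis j 1))\<^sup>2"
proof -
  have v': "v \<in> psd_cone" "v 0 = 1"
    using v by (simp_all add: moment_states_def)
  let ?x = "\<lambda>i. axis i (1::nat)"
  \<comment> \<open>The summand \<open>1\<close> makes \<open>c\<close> strictly larger than
    \<open>|v (?x j)|\<close>, so both normalising constants \<open>t 1\<close> and
    \<open>t (-1)\<close> are positive.\<close>
  define c where "c = sqrt \<rho> + 1"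
  have "(v (?x j))\<^sup>2 \<le> \<rho>"
    using square_moment_le[OF v, of "?x j"] mvar_square_le[OF v'(1), of j 1] v'(2)
    by (simp add: mvar_def mult_single)
  then have "\<bar>v (?x j)\<bar> \<le> sqrt \<rho>"
    by (simp add: real_le_rsqrt)
  then have bounds: "- c < v (?x j)" "v (?x j) < c" "sqrt \<rho> \<le> c"
    by (auto simp: c_def)
  define t where "t e = c + e * v (?x j)" for e :: real
  define w where "w e = (\<lambda>\<alpha>. (1 / t e) * twist (mconst c + mconst e * mvar j) v \<alpha>)" for e
  have w_eq: "w e \<alpha> = (c * v \<alpha> + e * v (?x j + \<alpha>)) / t e" for e \<alpha>
    by (simp add: w_def twist_affine)
  have t_pos: "t 1 > 0" "t (-1) > 0" and c_pos: "c > 0"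
    using bounds by (simp_all add: t_def)
  have w_state: "w e \<in> moment_states" if "\<bar>e\<bar> = 1" "t e > 0" for e
  proof -
    have "w e \<in> psd_cone"
      unfolding w_def using that
      by (intro scale_in_psd_cone twist_affine_in_psd_cone v'(1) bounds(3)) simp_all
    moreover have "w e 0 = 1"
      using that v'(2) by (simp add: w_eq t_def)
    ultimately show ?thesis
      by (simp add: moment_states_def)
  qed
  have w1: "w 1 \<in> moment_states" and w2: "w (-1) \<in> moment_states"
    using w_state[of 1] w_state[of "-1"] t_pos by simp_all
  \<comment> \<open>The \<open>x_j\<close> terms cancel, and
    \<open>t 1 + t (-1) = 2 * c\<close>.\<close>
  have split: "v = (\<lambda>\<alpha>. (t 1 / (2 * c)) * w 1 \<alpha> + (t (-1) / (2 * c)) * w (-1) \<alpha>)"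
    using t_pos c_pos by (simp add: w_eq fun_eq_iff field_simps)
  define l where "l = t 1 / (2 * c)"
  have l: "0 < l" "l < 1" "t (-1) / (2 * c) = 1 - l"
    using t_pos c_pos by (simp_all add: l_def t_def field_simps)
  have v_split: "v \<alpha> = l * w 1 \<alpha> + (1 - l) * w (-1) \<alpha>" for \<alpha>
    using fun_cong[OF split, of \<alpha>] l(3) by (simp add: l_def)
  have "linearize v f = l * linearize (w 1) f + (1 - l) * linearize (w (-1)) f"
    by (subst split) (simp only: linearize_combination l(3) flip: l_def)
  then have "l * (linearize (w 1) f - linearize v f) + (1 - l) * (linearize (w (-1)) f - linearize v f) = 0"
    by (simp add: algebra_simps)
  moreover have "0 \<le> l * (linearize (w 1) f - linearize v f)"
    using minimal[OF w1] l by simp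
  moreover have "0 \<le> (1 - l) * (linearize (w (-1)) f - linearize v f)"
    using minimal[OF w2] l by simp
  ultimately have "linearize (w 1) f = linearize v f" "linearize (w (-1)) f = linearize v f"
    using l by (simp_all add: add_nonneg_eq_0_iff)
  then have max1: "(\<Sum>i\<in>UNIV. (w 1 (?x i))\<^sup>2) \<le> (\<Sum>i\<in>UNIV. (v (?x i))\<^sup>2)"
    and max2: "(\<Sum>i\<in>UNIV. (w (-1) (?x i))\<^sup>2) \<le> (\<Sum>i\<in>UNIV. (v (?x i))\<^sup>2)"
    using maximal w1 w2 by blast+
  \<comment> \<open>The convexity defect of the square between the two twists; it vanishes only
    where they agree.\<close>
  let ?d = "\<lambda>i. l * (1 - l) * (w 1 (?x i) - w (-1) (?x i))\<^sup>2"
  have d: "?d i = l * (w 1 (?x i))\<^sup>2 + (1 - l) * (w (-1) (?x i))\<^sup>2 - (v (?x i))\<^sup>2" for i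
    unfolding v_split[of "?x i"] by (simp add: power2_eq_square algebra_simps)
  have "(\<Sum>i\<in>UNIV. ?d i) = l * (\<Sum>i\<in>UNIV. (w 1 (?x i))\<^sup>2)
      + (1 - l) * (\<Sum>i\<in>UNIV. (w (-1) (?x i))\<^sup>2) - (\<Sum>i\<in>UNIV. (v (?x i))\<^sup>2)"
    unfolding d by (simp add: sum.distrib sum_subtractf sum_distrib_left)
  also have "\<dots> \<le> l * (\<Sum>i\<in>UNIV. (v (?x i))\<^sup>2)
      + (1 - l) * (\<Sum>i\<in>UNIV. (v (?x i))\<^sup>2) - (\<Sum>i\<in>UNIV. (v (?x i))\<^sup>2)"
    using max1 max2 l by (intro diff_right_mono add_mono mult_left_mono) simp_all
  also have "\<dots> = 0"
    by (simp add: algebra_simps)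
  finally have "(\<Sum>i\<in>UNIV. ?d i) \<le> 0" .
  moreover have d_nonneg: "0 \<le> ?d i" for i
    using l by simp
  ultimately have "(\<Sum>i\<in>UNIV. ?d i) = 0"
    by (meson antisym sum_nonneg)
  then have "?d j = 0"
    by (rule sum_nonneg_0[of UNIV ?d, rotated 2]) (use d_nonneg in simp_all)
  then have "w 1 (?x j) = w (-1) (?x j)"
    using l by simp
  then have "w 1 (?x j) = v (?x j)"
    using v_split[of "?x j"] by (simp add: algebra_simps)
  then have "c * v (?x j) + v (?x j + ?x j) = t 1 * v (?x j)"
    using t_pos by (simp add: w_eq field_simps)
  then show ?thesis
    by (simp add: t_def power2_eq_square algebra_simps)
qed

text \<open>For \<open>u = x_j - v (axis j 1)\<close> zero variance says
  \<open>L_v (u u) = 0\<close>. Cauchy-Schwarz then kills \<open>u\<close> times any monomial, so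
  \<open>v\<close> is multiplicative.\<close>

lemma zero_variance_state_eq_monom_eval:
  assumes v: "v \<in> moment_states"
    and var: "\<And>j. v (axis j 1 + axis j 1) = (v (axis j 1))\<^sup>2"
  shows "v = monom_eval (\<chi> j. v (axis j 1))"
proof
  fix \<alpha>
  have v': "nonneg_on_squares v" "v 0 = 1"
    using v psd_cone_nonneg_on_squares by (auto simp: moment_states_def)
  have mult: "v (axis j 1 + \<beta>) = v (axis j 1) * v \<beta>" for j \<beta>
  proof -
    define u where "u = mvar j - mconst (v (axis j 1))"
    \<comment> \<open>The trailing factor \<open>1\<close> lets the scaling rule for
      \<open>linearize\<close> handle the constant term too.\<close>
    have "u * u = mvar j * mvar j - mconst (v (axis j 1)) * mvar j
        - mconst (v (axis j 1)) * mvar j + mconst (v (axis j 1)) * (mconst (v (axis j 1)) * 1)"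
      by (simp add: u_def algebra_simps)
    then have "linearize v (u * u) = linearize v (mvar j * mvar j) - v (axis j 1) * linearize v (mvar j)
        - v (axis j 1) * linearize v (mvar j) + v (axis j 1) * (v (axis j 1) * linearize v 1)"
      by (simp only: linearize_add linearize_diff linearize_mconst_mult)
    also have "\<dots> = 0"
      using var[of j] by (simp add: mvar_def mult_single v' power2_eq_square)
    finally have "linearize v (u * u) = 0" .
    then have "linearize v (u * Poly_Mapping.single \<beta> 1) = 0"
      using nonneg_on_squares_Cauchy_Schwarz[OF v'(1), of u "Poly_Mapping.single \<beta> 1"] by simp
    then show ?thesis
      by (simp add: u_def left_diff_distrib mvar_mult_single linearize_diff linearize_mconst_mult)
  qed
  show "v \<alpha> = monom_eval (\<chi> j. v (axis j 1)) \<alpha>"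
    by (induction \<alpha> rule: expo_induct) (simp_all add: v' mult monom_eval_add del: One_nat_def)
qed

text \<open>Two successive optimisations over compact sets, first of \<open>f\<close> and then of
  the sum of squares over the minimisers, end at a point evaluation.\<close>

lemma exists_point_le_linearize:
  assumes "v \<in> moment_states"
  shows "\<exists>x. (\<forall>h\<in>G. 0 \<le> mpoly_eval h x) \<and> mpoly_eval f x \<le> linearize v f"
proof -
  obtain m where m: "m \<in> moment_states"
    and m_min: "\<And>w. w \<in> moment_states \<Longrightarrow> linearize m f \<le> linearize w f"
    using continuous_attains_inf[OF compact_moment_states _ continuous_linearize] assms by blast
  define F where "F = moment_states \<inter> {w. linearize w f = linearize m f}"
  have "closed {w. linearize w f = linearize m f}"
    by (intro closed_Collect_eq continuous_linearize continuous_on_const)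
  then have "compact F"
    unfolding F_def by (intro compact_Int_closed compact_moment_states)
  moreover have "continuous_on F (\<lambda>w. \<Sum>i\<in>UNIV. (w (axis i 1))\<^sup>2)"
    by (intro continuous_intros continuous_on_subset[OF continuous_on_product_coordinates]) simp
  ultimately obtain w where w: "w \<in> F"
    and w_max: "\<And>u. u \<in> F \<Longrightarrow> (\<Sum>i\<in>UNIV. (u (axis i 1))\<^sup>2) \<le> (\<Sum>i\<in>UNIV. (w (axis i 1))\<^sup>2)"
    using continuous_attains_sup[of F "\<lambda>w. \<Sum>i\<in>UNIV. (w (axis i 1))\<^sup>2"] m
    by (auto simp: F_def)
  have w_state: "w \<in> moment_states" and wm: "linearize w f = linearize m f"
    using w by (simp_all add: F_def)
  have "w (axis j 1 + axis j 1) = (w (axis j 1))\<^sup>2" for j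
    by (rule extremal_state_zero_variance[OF w_state, of f])
      (use m_min w_max in \<open>auto simp: F_def wm\<close>)
  then have "w = monom_eval (\<chi> j. w (axis j 1))"
    by (rule zero_variance_state_eq_monom_eval[OF w_state])
  then obtain x where x: "w = monom_eval x"
    by blast
  \<comment> \<open>For an evaluation, positivity on \<open>h * (p * p)\<close> with
    \<open>p = 1\<close> reads \<open>h(x) \<ge> 0\<close>.\<close>
  have "0 \<le> mpoly_eval h x" if "h \<in> G" for h
    using psd_coneD[of w h 1] w_state that by (simp add: moment_states_def mpoly_eval_linearize x)
  moreover have "mpoly_eval f x \<le> linearize v f"
    using m_min[OF assms] wm by (simp add: mpoly_eval_linearize x)
  ultimately show ?thesis
    by blast
qed

end

subsection \<open>Compactness of finite-dimensional convex hulls\<close>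

text \<open>Translating one point to the origin leaves more than \<open>card B\<close> vectors in
  \<open>span B\<close>. The set \<open>B\<close> stands in for the dimension, since the ambient
  space may be infinite-dimensional.\<close>

lemma affine_dependent_if_card_gt:
  fixes S :: "'a::real_vector set"
  assumes "finite S" "finite B" "S \<subseteq> span B" "card S > card B + 1"
  shows "affine_dependent S"
proof -
  obtain a where a: "a \<in> S"
    using assms(4) by fastforce
  let ?T = "{x - a |x. x \<in> S - {a}}"
  have T: "?T = (\<lambda>x. x - a) ` (S - {a})"
    by auto
  have "card ?T = card S - 1"
    unfolding T using a assms(1) by (simp add: card_image)
  moreover have "?T \<subseteq> span B"
    using a assms(3) by (auto intro: span_diff)
  ultimately have "dependent ?T"
    using independent_span_bound[OF assms(2), of ?T] assms(4) by fastforce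
  then have "affine_dependent (insert a (S - {a}))"
    by (rule dependent_imp_affine_dependent) simp
  then show ?thesis
    using a by (simp add: insert_absorb)
qed

text \<open>Caratheodory's exchange: the coefficients \<open>u\<close> move along an affine relation
  \<open>w\<close> until one vanishes.\<close>

lemma convex_hull_affine_dependent:
  fixes S :: "'a::real_vector set"
  assumes "finite S" "affine_dependent S" "y \<in> convex hull S"
  shows "\<exists>a\<in>S. y \<in> convex hull (S - {a})"
proof -
  obtain u where u: "\<And>x. x \<in> S \<Longrightarrow> 0 \<le> u x" "sum u S = 1" "(\<Sum>x\<in>S. u x *\<^sub>R x) = y"
    using assms(1,3) by (auto simp: convex_hull_finite)
  obtain w where w: "sum w S = 0" "\<exists>x\<in>S. w x \<noteq> 0" "(\<Sum>x\<in>S. w x *\<^sub>R x) = 0"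
    using assms(2) unfolding affine_dependent_explicit_finite[OF assms(1)] by blast
  \<comment> \<open>The entries of \<open>w\<close> sum to zero and are not all zero.\<close>
  have "{x \<in> S. w x < 0} \<noteq> {}"
  proof
    assume "{x \<in> S. w x < 0} = {}"
    then have "0 \<le> w x" if "x \<in> S" for x
      using that by (auto simp: not_less)
    then have "w x = 0" if "x \<in> S" for x
      using that w(1) assms(1) by (intro sum_nonneg_0[of S w]) auto
    with w(2) show False
      by blast
  qed
  then obtain a where "is_arg_min (\<lambda>x. u x / - w x) (\<lambda>x. x \<in> {x \<in> S. w x < 0}) a"
    using ex_is_arg_min_if_finite[of "{x \<in> S. w x < 0}" "\<lambda>x. u x / - w x"] assms(1) by auto
  then have a: "a \<in> S" "w a < 0"
    and a_min: "\<And>x. x \<in> S \<Longrightarrow> w x < 0 \<Longrightarrow> u a / - w a \<le> u x / - w x"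
    unfolding is_arg_min_linorder by simp_all
  \<comment> \<open>The largest step that keeps \<open>u + t * w\<close> nonnegative; it is limited
    by the point \<open>a\<close>, which drops out.\<close>
  define t where "t = u a / - w a"
  have t: "0 \<le> t" "u a + t * w a = 0"
    using a u(1) by (simp_all add: t_def divide_nonneg_neg)
  define z where "z x = u x + t * w x" for x
  have z_nonneg: "0 \<le> z x" if "x \<in> S" for x
  proof (cases "w x < 0")
    case True
    then have "t \<le> u x / - w x"
      using a_min[OF that] by (simp only: t_def)
    then have "t * - w x \<le> u x"
      using True by (subst (asm) pos_le_divide_eq) simp_all
    then show ?thesis
      by (simp add: z_def)
  next
    case False
    then show ?thesis
      using u(1)[OF that] t(1) by (simp add: z_def)
  qed
  have "z a = 0"
    using t(2) by (simp add: z_def)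
  have "sum z S = 1"
    by (simp add: z_def sum.distrib u w flip: sum_distrib_left)
  moreover have "(\<Sum>x\<in>S. z x *\<^sub>R x) = y"
    by (simp add: z_def scaleR_left_distrib sum.distrib u w
        flip: scaleR_scaleR scaleR_right.sum)
  ultimately have "sum z (S - {a}) = 1" "(\<Sum>x\<in>S - {a}. z x *\<^sub>R x) = y"
    using \<open>z a = 0\<close> assms(1) a(1) by (simp_all add: sum_diff1)
  then have "y \<in> convex hull (S - {a})"
    using z_nonneg assms(1) by (auto simp: convex_hull_finite)
  then show ?thesis
    using a by blast
qed

text \<open>A representing subset of least cardinality cannot be affinely dependent, since the
  exchange would shrink it.\<close>

lemma convex_hull_caratheodory_span:
  fixes S :: "'a::real_vector set"
  assumes "finite B" "S \<subseteq> span B" "y \<in> convex hull S"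
  obtains T where "finite T" "T \<subseteq> S" "card T \<le> card B + 1" "y \<in> convex hull T"
proof -
  define P where "P T \<longleftrightarrow> finite T \<and> T \<subseteq> S \<and> y \<in> convex hull T" for T
  obtain T0 where "P T0"
  proof -
    obtain T0 u where "finite T0" "T0 \<subseteq> S" "\<forall>x\<in>T0. 0 \<le> u x" "sum u T0 = 1" "(\<Sum>v\<in>T0. u v *\<^sub>R v) = y"
      using assms(3) unfolding convex_hull_explicit by blast
    then show ?thesis
      by (intro that[of T0]) (auto simp: P_def convex_hull_finite)
  qed
  then obtain T where T: "P T" and T_min: "\<And>T'. P T' \<Longrightarrow> card T \<le> card T'"
    using ex_has_least_nat[of P T0 card] by blast
  have "card T \<le> card B + 1"
  proof (rule ccontr)
    assume "\<not> card T \<le> card B + 1"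
    then have "affine_dependent T"
      using T assms by (intro affine_dependent_if_card_gt[of T B]) (auto simp: P_def)
    then obtain a where a: "a \<in> T" "y \<in> convex hull (T - {a})"
      using convex_hull_affine_dependent[of T y] T by (auto simp: P_def)
    then have "P (T - {a})"
      using T by (auto simp: P_def)
    then have "card T \<le> card (T - {a})"
      by (rule T_min)
    moreover have "card (T - {a}) < card T"
      using a T by (intro card_Diff1_less) (auto simp: P_def)
    ultimately show False
      by simp
  qed
  then show ?thesis
    using T that by (auto simp: P_def)
qed

text \<open>Level \<open>n\<close> holds the convex combinations of \<open>n + 1\<close> points,
  repetitions allowed. Building them by binary steps passes compactness from level to level.\<close>

fun iterated_join :: "'a::real_vector set \<Rightarrow> nat \<Rightarrow> 'a set" where
  "iterated_join S 0 = S"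
| "iterated_join S (Suc n) =
    {(1 - u) *\<^sub>R x + u *\<^sub>R y | x y u. 0 \<le> u \<and> u \<le> 1 \<and> x \<in> S \<and> y \<in> iterated_join S n}"

lemma compact_iterated_join:
  fixes S :: "'a::real_normed_vector set"
  shows "compact S \<Longrightarrow> compact (iterated_join S n)"
  by (induction n) (simp_all add: compact_convex_combinations)

lemma iterated_join_subset_convex_hull: "iterated_join S n \<subseteq> convex hull S"
proof (induction n)
  case (Suc n)
  then show ?case
    by (auto intro!: convexD[OF convex_convex_hull] intro: hull_inc)
qed (simp add: hull_subset)

lemma convex_hull_subset_iterated_join:
  assumes "finite T" "T \<subseteq> S" "card T \<le> n + 1"
  shows "convex hull T \<subseteq> iterated_join S n"
  using assms
proof (induction n arbitrary: T)
  case 0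
  then consider "T = {}" | x where "T = {x}"
    by (metis One_nat_def add_0 card_0_eq card_1_singletonE le_SucE le_zero_eq)
  then show ?case
    using 0 by cases auto
next
  case (Suc n)
  show ?case
  proof (cases "T = {}")
    case False
    then obtain a where a: "a \<in> T"
      by blast
    define R where "R = T - {a}"
    have T: "T = insert a R"
      using a by (auto simp: R_def)
    have R: "convex hull R \<subseteq> iterated_join S n"
      using Suc.prems a by (intro Suc.IH) (auto simp: R_def)
    show ?thesis
    proof (cases "R = {}")
      case True
      \<comment> \<open>A single point climbs one level by being joined to itself with weight
        \<open>0\<close>.\<close>
      have "a \<in> iterated_join S n"
        using Suc.IH[of "{a}"] Suc.prems a by auto
      then have "(1 - 0) *\<^sub>R a + 0 *\<^sub>R a \<in> iterated_join S (Suc n)"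
        using Suc.prems(2) a unfolding iterated_join.simps mem_Collect_eq
        by (rule_tac exI[of _ a], rule_tac exI[of _ a], rule_tac exI[of _ 0]) auto
      then show ?thesis
        using True T by simp
    next
      case False
      show ?thesis
      proof
        fix y assume "y \<in> convex hull T"
        then obtain u v b where "u \<ge> 0" "v \<ge> 0" "u + v = 1" "b \<in> convex hull R"
          and y: "y = u *\<^sub>R a + v *\<^sub>R b"
          unfolding T convex_hull_insert[OF False] by blast
        then have "u = 1 - v" "0 \<le> v" "v \<le> 1" "b \<in> iterated_join S n"
          using R by auto
        then show "y \<in> iterated_join S (Suc n)"
          using y Suc.prems(2) a unfolding iterated_join.simps mem_Collect_eq
          by (rule_tac exI[of _ a], rule_tac exI[of _ b], rule_tac exI[of _ v]) auto
      qed
    qed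
  qed simp
qed

text \<open>By Caratheodory the hull is already reached at level \<open>card B\<close> of the
  iterated joins.\<close>

lemma compact_convex_hull_span:
  fixes S :: "'a::real_normed_vector set"
  assumes "compact S" "finite B" "S \<subseteq> span B"
  shows "compact (convex hull S)"
proof -
  have "convex hull S \<subseteq> iterated_join S (card B)"
  proof
    fix y assume "y \<in> convex hull S"
    from convex_hull_caratheodory_span[OF assms(2,3) this] show "y \<in> iterated_join S (card B)"
      using convex_hull_subset_iterated_join by (metis subsetD)
  qed
  then have "convex hull S = iterated_join S (card B)"
    using iterated_join_subset_convex_hull by blast
  then show ?thesis
    using compact_iterated_join[OF assms(1)] by simp
qed

section \<open>Coordinates of finitely supported families and compactness of the moment body\<close>

lemma lookup_scaleR: "Poly_Mapping.lookup (c *\<^sub>R f) \<alpha> = c *\<^sub>R Poly_Mapping.lookup f \<alpha>"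
proof -
  have "finite {i. c *\<^sub>R Poly_Mapping.lookup f i \<noteq> 0}"
    by (rule finite_subset[OF _ finite_lookup[of f]]) auto
  then show ?thesis
    by (simp add: scaleR_poly_mapping_def)
qed

lemma dist_lookup_le: "dist (Poly_Mapping.lookup f \<alpha>) (Poly_Mapping.lookup h \<alpha>) \<le> dist f h"
proof (cases "\<alpha> \<in> Poly_Mapping.keys f \<union> Poly_Mapping.keys h")
  case True
  then show ?thesis
    unfolding dist_poly_mapping_def
    by (intro member_le_sum[where f = "\<lambda>n. dist (Poly_Mapping.lookup f n) (Poly_Mapping.lookup h n)"])
      auto
next
  case False
  then show ?thesis
    by (simp add: in_keys_iff)
qed

lemma continuous_on_lookup: "continuous_on S (\<lambda>f. Poly_Mapping.lookup f \<alpha>)"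
  unfolding continuous_on_iff by (meson dist_lookup_le le_less_trans)

lemma single_eq_scaleR: "Poly_Mapping.single \<alpha> (c::real) = c *\<^sub>R Poly_Mapping.single \<alpha> 1"
  by (rule poly_mapping_eqI) (simp add: lookup_scaleR lookup_single when_def)

lemma proj_eq_scaleR: "proj A v = (\<Sum>\<alpha>\<in>A. v \<alpha> *\<^sub>R Poly_Mapping.single \<alpha> 1)"
  by (simp add: proj_def flip: single_eq_scaleR)

lemma continuous_monom_eval: "continuous_on S (\<lambda>x. monom_eval x \<alpha>)"
  unfolding monom_eval_def by (intro continuous_intros)

lemma compact_moment_body:
  assumes "compact X" "finite A"
  shows "compact (moment_body A X)"
  unfolding moment_body_def
proof (rule compact_convex_hull_span)
  show "compact ((\<lambda>x. proj A (monom_eval x)) ` X)"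
    unfolding proj_eq_scaleR using assms(1)
    by (intro compact_continuous_image continuous_intros continuous_monom_eval)
  show "finite ((\<lambda>\<alpha>. Poly_Mapping.single \<alpha> (1::real)) ` A)"
    using assms(2) by simp
  show "(\<lambda>x. proj A (monom_eval x)) ` X \<subseteq> span ((\<lambda>\<alpha>. Poly_Mapping.single \<alpha> 1) ` A)"
    unfolding proj_eq_scaleR by (intro image_subsetI span_sum span_scale) (simp add: span_base)
qed

text \<open>The point \<open>c\<close> minimises the squared distance to \<open>v\<close> over the
  coordinates in \<open>A\<close>; the inequality is first-order optimality along the segment from
  \<open>c\<close> to \<open>z\<close>.\<close>

lemma closest_point_obtuse:
  fixes C :: "('a \<Rightarrow>\<^sub>0 real) set"
  assumes "compact C" "convex C" "C \<noteq> {}"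
  obtains c where "c \<in> C" "\<And>z. z \<in> C \<Longrightarrow>
    0 \<le> (\<Sum>\<alpha>\<in>A. (Poly_Mapping.lookup z \<alpha> - Poly_Mapping.lookup c \<alpha>) * (Poly_Mapping.lookup c \<alpha> - v \<alpha>))"
proof -
  define D where "D z = (\<Sum>\<alpha>\<in>A. (Poly_Mapping.lookup z \<alpha> - v \<alpha>)\<^sup>2)" for z
  have "continuous_on C D"
    unfolding D_def by (intro continuous_intros continuous_on_lookup)
  then obtain c where c: "c \<in> C" and c_min: "\<And>z. z \<in> C \<Longrightarrow> D c \<le> D z"
    using continuous_attains_inf[OF assms(1,3)] by blast
  have "0 \<le> (\<Sum>\<alpha>\<in>A. (Poly_Mapping.lookup z \<alpha> - Poly_Mapping.lookup c \<alpha>) * (Poly_Mapping.lookup c \<alpha> - v \<alpha>))"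
    (is "0 \<le> ?I") if z: "z \<in> C" for z
  proof -
    define Q where "Q = (\<Sum>\<alpha>\<in>A. (Poly_Mapping.lookup z \<alpha> - Poly_Mapping.lookup c \<alpha>)\<^sup>2)"
    have "Poly_Mapping.lookup ((1 - u) *\<^sub>R c + u *\<^sub>R z) \<alpha> =
        (1 - u) * Poly_Mapping.lookup c \<alpha> + u * Poly_Mapping.lookup z \<alpha>" for u \<alpha>
      by (simp add: lookup_add lookup_scaleR)
    then have expand: "D ((1 - u) *\<^sub>R c + u *\<^sub>R z) = D c + 2 * u * ?I + u\<^sup>2 * Q" for u
      unfolding D_def Q_def sum_distrib_left sum.distrib[symmetric]
      by (intro sum.cong refl)
        (simp add: power2_eq_square, simp add: algebra_simps)
    have step: "0 \<le> 2 * ?I + u * Q" if "0 < u" "u \<le> 1" for u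
    proof -
      have "(1 - u) *\<^sub>R c + u *\<^sub>R z \<in> C"
        using that z c by (intro convexD[OF assms(2)]) auto
      then have "0 \<le> u * (2 * ?I + u * Q)"
        using c_min expand[of u] by (fastforce simp: power2_eq_square algebra_simps)
      then show ?thesis
        using that by (simp add: zero_le_mult_iff)
    qed
    \<comment> \<open>Letting \<open>u\<close> tend to \<open>0\<close> from the right removes the
      quadratic contribution.\<close>
    have "((\<lambda>u. 2 * ?I + u * Q) \<longlongrightarrow> 2 * ?I + 0 * Q) (at_right 0)"
      by (intro tendsto_intros)
    moreover have "eventually (\<lambda>u. 0 \<le> 2 * ?I + u * Q) (at_right 0)"
      using step eventually_at_right[of 0 1] by (auto simp: eventually_at_right_field intro: exI[of _ 1])
    ultimately have "0 \<le> 2 * ?I + 0 * Q"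
      by (rule tendsto_lowerbound) simp
    then show ?thesis
      by simp
  qed
  with c that show ?thesis
    by blast
qed

subsection \<open>Separation from the moment body\<close>

text \<open>Let \<open>c\<close> be the point of the moment body nearest to \<open>v\<close>, and
  \<open>f\<close> the polynomial with coefficients \<open>c - v\<close>. Every point of
  \<open>X\<close> gives \<open>f\<close> a value exceeding \<open>L_v f\<close> by at least the
  squared distance, yet some point does not exceed \<open>L_v f\<close>; so the distance is
  zero.\<close>

lemma (in archimedean_generators) proj_moment_states:
  assumes "finite A" and X: "X = {x. \<forall>h\<in>G. 0 \<le> mpoly_eval h x}" and "compact X"
    and v: "v \<in> moment_states"
  shows "proj A v \<in> moment_body A X"
proof -
  have "X \<noteq> {}"
    using exists_point_le_linearize[OF v] X by blast
  then have "moment_body A X \<noteq> {}"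
    by (simp add: moment_body_def)
  then obtain c where c: "c \<in> moment_body A X"
    and obtuse: "\<And>z. z \<in> moment_body A X \<Longrightarrow>
      0 \<le> (\<Sum>\<alpha>\<in>A. (Poly_Mapping.lookup z \<alpha> - Poly_Mapping.lookup c \<alpha>) * (Poly_Mapping.lookup c \<alpha> - v \<alpha>))"
    using closest_point_obtuse[OF compact_moment_body[OF assms(3,1)], where A = A and v = v]
    by (auto simp: moment_body_def)
  define f where "f = (\<Sum>\<alpha>\<in>A. Poly_Mapping.single \<alpha> (Poly_Mapping.lookup c \<alpha> - v \<alpha>))"
  have f: "linearize w f = (\<Sum>\<alpha>\<in>A. w \<alpha> * (Poly_Mapping.lookup c \<alpha> - v \<alpha>))" for w
    by (simp add: f_def linearize_sum mult.commute)
  obtain x where x: "x \<in> X" "mpoly_eval f x \<le> linearize v f"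
    using exists_point_le_linearize[OF v, of f] X by blast
  have "proj A (monom_eval x) \<in> moment_body A X"
    using x(1) by (simp add: moment_body_def hull_inc)
  then have "0 \<le> (\<Sum>\<alpha>\<in>A. (monom_eval x \<alpha> - Poly_Mapping.lookup c \<alpha>) * (Poly_Mapping.lookup c \<alpha> - v \<alpha>))"
    using obtuse by (fastforce simp: lookup_proj assms(1))
  \<comment> \<open>With \<open>m\<close> for the moments of \<open>x\<close>, this is
    \<open>(m - c)(c - v) = (m - v)(c - v) - (c - v)^2\<close> summed over \<open>A\<close>.\<close>
  also have "\<dots> = linearize (monom_eval x) f - linearize v f - (\<Sum>\<alpha>\<in>A. (Poly_Mapping.lookup c \<alpha> - v \<alpha>)\<^sup>2)"
    unfolding f sum_subtractf[symmetric]
    by (intro sum.cong refl) (simp add: power2_eq_square algebra_simps)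
  finally have "(\<Sum>\<alpha>\<in>A. (Poly_Mapping.lookup c \<alpha> - v \<alpha>)\<^sup>2) \<le> 0"
    using x(2) by (simp add: mpoly_eval_linearize)
  then have "(\<Sum>\<alpha>\<in>A. (Poly_Mapping.lookup c \<alpha> - v \<alpha>)\<^sup>2) = 0"
    by (simp add: antisym sum_nonneg)
  then have on_A: "Poly_Mapping.lookup c \<alpha> = v \<alpha>" if "\<alpha> \<in> A" for \<alpha>
    using that assms(1) by (simp add: sum_nonneg_eq_0_iff)
  \<comment> \<open>Agreement on \<open>A\<close> suffices because the families supported in
    \<open>A\<close> form a convex set containing the generators of the hull, hence
    \<open>c\<close>.\<close>
  have "c = proj A (Poly_Mapping.lookup c)"
  proof -
    have "convex {f :: 'n expo \<Rightarrow>\<^sub>0 real. f = proj A (Poly_Mapping.lookup f)}"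
      by (auto simp: convex_def poly_mapping_eq_iff fun_eq_iff lookup_proj assms(1) lookup_add lookup_scaleR
          split: if_splits)
    moreover have "(\<lambda>x. proj A (monom_eval x)) ` X \<subseteq> {f. f = proj A (Poly_Mapping.lookup f)}"
      by (auto simp: poly_mapping_eq_iff fun_eq_iff lookup_proj assms(1))
    ultimately show ?thesis
      using c hull_minimal[of _ _ convex] unfolding moment_body_def by blast
  qed
  also have "\<dots> = proj A v"
    by (simp add: proj_def on_A)
  finally show ?thesis
    using c by simp
qed

text \<open>Evaluation at a point of \<open>X\<close> is a state, as
  \<open>h(x) p(x)^2 \<ge> 0\<close>; the states are convex and the projection is linear.\<close>

lemma (in archimedean_generators) moment_body_subset:
  assumes "finite A" and X: "X = {x. \<forall>h\<in>G. 0 \<le> mpoly_eval h x}"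
  shows "moment_body A X \<subseteq> proj A ` moment_states"
  unfolding moment_body_def
proof (rule hull_minimal)
  have "monom_eval x \<in> moment_states" if "x \<in> X" for x
    using that unfolding X moment_states_def psd_cone_def nonneg_on_squares_def
    by (simp add: linearize_twist mpoly_eval_mult flip: mpoly_eval_linearize)
  then show "(\<lambda>x. proj A (monom_eval x)) ` X \<subseteq> proj A ` moment_states"
    by blast
  show "convex (proj A ` moment_states)"
  proof (rule convexI)
    fix y z :: "'n expo \<Rightarrow>\<^sub>0 real" and a b :: real
    assume "y \<in> proj A ` moment_states" "z \<in> proj A ` moment_states" and ab: "0 \<le> a" "0 \<le> b" "a + b = 1"
    then obtain v w where vw: "v \<in> moment_states" "w \<in> moment_states" "y = proj A v" "z = proj A w"
      by blast
    have "(\<lambda>\<alpha>. a * v \<alpha> + b * w \<alpha>) \<in> moment_states"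
      using vw ab by (simp add: moment_states_def psd_cone_def nonneg_on_squares_def linearize_twist
          linearize_combination)
    moreover have "a *\<^sub>R y + b *\<^sub>R z = proj A (\<lambda>\<alpha>. a * v \<alpha> + b * w \<alpha>)"
      by (rule poly_mapping_eqI) (simp add: vw lookup_add lookup_scaleR lookup_proj assms(1))
    ultimately show "a *\<^sub>R y + b *\<^sub>R z \<in> proj A ` moment_states"
      by blast
  qed
qed

section \<open>Specialisation to the given inequalities\<close>

theorem theorem2p4:
  fixes g :: "nat \<Rightarrow> 'n::finite mpoly"
    and s :: nat
    and \<rho> :: real
    and X :: "(real ^ 'n) set"
    and A :: "'n expo set"
  assumes "X = {x. \<forall>i\<in>{1..s}. mpoly_eval (g i) x \<ge> 0}"
    and "compact X"
    and "\<rho> > 0"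
    and "X \<subseteq> {x. (\<Sum>i\<in>UNIV. (x $ i)\<^sup>2) \<le> \<rho>}"
    and "g 0 = 1"
    and "g (s + 1) = mconst \<rho> - (\<Sum>i\<in>UNIV. (mvar i)\<^sup>2)"
    and "finite A"
    and "A \<subseteq> UNIV - {0}"
  shows "moment_body A X =
    proj A ` {v. v 0 = 1 \<and>
      (\<forall>i\<in>{0..s+1}. psd_infinite (\<lambda>\<alpha> \<beta>. linearize v (g i * moment_matrix \<alpha> \<beta>)))}"
proof -
  let ?G = "g ` {0..s+1}"
  interpret archimedean_generators ?G \<rho>
  proof
    show "1 \<in> ?G"
      using assms(5) by (intro image_eqI[of _ _ 0]) simp_all
    show "mconst \<rho> - (\<Sum>i\<in>UNIV. (mvar i)\<^sup>2) \<in> ?G"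
      using assms(6) by (intro image_eqI[of _ _ "s + 1"]) simp_all
  qed (rule assms(3))
  have states: "{v. v 0 = 1 \<and>
      (\<forall>i\<in>{0..s+1}. psd_infinite (\<lambda>\<alpha> \<beta>. linearize v (g i * moment_matrix \<alpha> \<beta>)))} = moment_states"
    unfolding psd_infinite_iff moment_states_def psd_cone_def by auto
  have "mpoly_eval (g 0) x = 1" for x
    by (simp add: assms(5) mpoly_eval_linearize)
  moreover have "mpoly_eval (g (s + 1)) x = \<rho> - (\<Sum>i\<in>UNIV. (x $ i)\<^sup>2)" for x
  proof -
    have "linearize (monom_eval x) (mvar i * mvar i) = (x $ i)\<^sup>2" for i
      using mpoly_eval_mult[of "mvar i" "mvar i" x]
      by (simp add: mpoly_eval_linearize mvar_def power2_eq_square del: One_nat_def)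
    then show ?thesis
      unfolding assms(6)
      by (simp add: mpoly_eval_linearize linearize_diff linearize_sum power2_eq_square mconst_def)
  qed
  moreover have "{0..s+1} = insert 0 (insert (s + 1) {1..s})"
    by auto
  \<comment> \<open>Adding the constraints for \<open>g 0\<close> and \<open>g (s + 1)\<close>
    leaves \<open>X\<close> unchanged: the first is \<open>1 \<ge> 0\<close>, the second holds
    because \<open>X\<close> lies in the ball.\<close>
  ultimately have X: "X = {x. \<forall>h\<in>?G. 0 \<le> mpoly_eval h x}"
    using assms(1,4) by auto
  show ?thesis
    unfolding states
    using moment_body_subset[OF assms(7) X] proj_moment_states[OF assms(7) X assms(2)] by blast
qed

end
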